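(* For integers $p,q\ge 0$, at least one of which is positive, and $r\ge 1$, let $$K(r,p,q):=\int_0^1\frac{\log^r(x)\,\mathrm{Li}_p(x)\,\mathrm{Li}_q(x)}{x}\,dx ,\qquad w:=p+q+r .$$ (a) If $w$ is even, then $K(r,p,q)$ is reducible to zeta values at positive integers; that is, it is a linear combination with rational coefficients of finite nonempty products of values $\zeta(n)$ with integers $n\ge 2$. (b) If $w$ is odd, then the integrals $K(r,p,q)$ of weight $w$ are reducible to zeta values at positive integers and at most $\lfloor (w-1)/6\rfloor$ other constants, which can be taken from the set $$\mathcal S_w=\left\{\kappa_{2j-1,\,w-2j+1} : j=1,\ldots,\lfloor (w+1)/4\rfloor\right\},\qquad \kappa_{rq}:=\frac{K(r,0,q)}{r!}.$$ That is, for each odd $w$ there is a subset $T\subseteq \mathcal S_w$ with at most $\lfloor (w-1)/6\rfloor$ elements such that every $K(r,p,q)$ with $p,q\ge 0$ not both zero, $r\ge 1$ and $p+q+r=w$ is a linear combination with rational coefficients of elements of $T$ and finite nonempty products of values $\zeta(n)$ with integers $n\ge 2$.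
   Context: For an integer $p$ and $|x|<1$, $\mathrm{Li}_p(x)=\sum_{k\ge 1} x^k/k^p$ is the polylogarithm; in particular $\mathrm{Li}_0(x)=x/(1-x)$ and $\mathrm{Li}_1(x)=-\log(1-x)$, so that $K(r,0,q)=\int_0^1 \log^r(x)\,\mathrm{Li}_q(x)/(1-x)\,dx$. $\zeta$ is the Riemann zeta function. A quantity is called reducible to given constants if it can be expressed as a rational linear combination of them, where products of zeta values are allowed. *)

theory Defs
  imports "HOL-Analysis.Analysis"
begin

definition polylog :: "int \<Rightarrow> real \<Rightarrow> real" where
  "polylog p x = (\<Sum>k. x ^ Suc k / real (Suc k) powi p)"

(* Only meant for n >= 2, where the series converges. *)
definition zeta :: "nat \<Rightarrow> real" where
  "zeta n = (\<Sum>k. 1 / real (Suc k) ^ n)"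

(* The integrand is absolutely integrable on (0,1) whenever r >= 1 and p, q are not both 0. *)
definition K :: "nat \<Rightarrow> nat \<Rightarrow> nat \<Rightarrow> real" where
  "K r p q = (LBINT x:{0<..<1}. ln x ^ r * polylog (int p) x * polylog (int q) x / x)"

definition kappa :: "nat \<Rightarrow> nat \<Rightarrow> real" where
  "kappa r q = K r 0 q / fact r"

(* For w >= 1 the range of j gives 2 * j <= w, so the natural subtractions do not truncate. *)
definition kappa_set :: "nat \<Rightarrow> real set" where
  "kappa_set w = {kappa (2 * j - 1) (w - 2 * j + 1) | j. 1 \<le> j \<and> j \<le> (w + 1) div 4}"

definition zeta_products :: "real set" where
  "zeta_products = {prod_list (map zeta ns) | ns. ns \<noteq> [] \<and> (\<forall>n\<in>set ns. n \<ge> 2)}"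

global_interpretation rat_real: vector_space "\<lambda>(c::rat) (x::real). of_rat c * x"
  defines rat_span = rat_real.span
  by unfold_locales (simp_all add: algebra_simps of_rat_add of_rat_mult)

lemma polylog_0:
  assumes "\<bar>x\<bar> < 1"
  shows "polylog 0 x = x / (1 - x)"
  using suminf_mult[OF summable_geometric, of x x] suminf_geometric[of x] assms
  by (simp add: polylog_def)

lemma finite_kappa_set: "finite (kappa_set w)"
  unfolding kappa_set_def by (rule finite_image_set) simp

end

theory Submission
  imports Defs
begin

text \<open>Expanding the polylogarithms turns \<open>K r p q\<close> into \<open>(-1)^r r!\<close> times the Tornheim sum of
  \<open>1 / (m^p n^q (m + n)^(r + 1))\<close>, and partial fractions reduce Tornheim sums to double zeta
  values. To see which of these are needed modulo zeta products, take a rational linear functional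
  that kills the products. By the double shuffle relations its values on the double zeta values of
  weight \<open>d + 2\<close> are the coefficients of a polynomial \<open>f\<close> with \<open>t^d f(1/t) = -f(t)\<close> and
  \<open>f(1 - t) = -f(t)\<close>. If \<open>d\<close> is odd, \<open>f\<close> vanishes. If \<open>d\<close> is even and \<open>f\<close> is nonzero, its order
  \<open>m\<close> at 0 is odd and \<open>3 m + 3 \<le> d\<close>, so \<open>f\<close> is determined by its coefficients at the odd
  exponents \<open>1, 3, ..., 2 \<lfloor>d/6\<rfloor> - 1\<close>, which are the values at the first \<open>\<lfloor>d/6\<rfloor>\<close>
  constants \<open>\<kappa>\<close>.\<close>

section \<open>Tornheim sums\<close>

definition tornheim_term :: "nat \<Rightarrow> nat \<Rightarrow> nat \<Rightarrow> nat \<times> nat \<Rightarrow> real" where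
  "tornheim_term p q s = (\<lambda>(m, n). 1 / (real (Suc m) ^ p * real (Suc n) ^ q * real (Suc m + Suc n) ^ s))"

text \<open>With first exponent 0 this is a double zeta value: in \<open>tornheim 0 q s\<close> the
  exponent \<open>s\<close> belongs to the larger summation index and \<open>q\<close> to the
  smaller one.\<close>

definition tornheim :: "nat \<Rightarrow> nat \<Rightarrow> nat \<Rightarrow> real" where
  "tornheim p q s = infsum (tornheim_term p q s) UNIV"

lemma tornheim_term_nonneg: "tornheim_term p q s x \<ge> 0"
  by (auto simp: tornheim_term_def split: prod.split)

lemma tornheim_term_swap: "tornheim_term p q s (prod.swap x) = tornheim_term q p s x"
  by (cases x) (simp add: tornheim_term_def add_ac mult_ac)

lemma summable_tornheim_swap:
  "tornheim_term p q s summable_on UNIV \<longleftrightarrow> tornheim_term q p s summable_on UNIV"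
  using summable_on_reindex_bij_betw[OF bij_swap, of "tornheim_term p q s"]
  by (simp add: tornheim_term_swap)

lemma tornheim_commute: "tornheim p q s = tornheim q p s"
  unfolding tornheim_def
  using infsum_reindex_bij_betw[OF bij_swap, of "tornheim_term p q s"]
  by (simp add: tornheim_term_swap)

section \<open>Absolute convergence of Tornheim sums\<close>

lemma summable_product_powr: "(\<lambda>(m, n). real (Suc m) powr (-3/2) * real (Suc n) powr (-3/2)) summable_on UNIV"
proof -
  have *: "(\<lambda>n. real (Suc n) powr (-3/2)) summable_on UNIV"
    by (intro summable_nonneg_imp_summable_on)
      (use summable_real_powr_iff[of "-3/2"] summable_Suc_iff[of "\<lambda>n. real n powr (-3/2)"] in auto)
  have "(\<lambda>(m, n). real (Suc m) powr (-3/2) * real (Suc n) powr (-3/2)) summable_on UNIV \<times> UNIV"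
    by (rule summable_on_SigmaI[where g = "\<lambda>m. real (Suc m) powr (-3/2) * infsum (\<lambda>n. real (Suc n) powr (-3/2)) UNIV"])
      (use * in \<open>auto intro!: has_sum_cmult_right summable_on_cmult_left has_sum_infsum simp del: of_nat_Suc\<close>)
  then show ?thesis by simp
qed

lemma powr_three_halves: "x > 0 \<Longrightarrow> x powr - (3/2) = 1 / (x * sqrt x)" for x :: real
  using powr_add[of x 1 "1/2"] by (simp add: powr_minus_divide powr_half_sqrt)

text \<open>The last three inequalities are the convergence conditions of the series. The first
  excludes \<open>p = q = 0\<close>, where \<open>tornheim_eq_shuffle_parts\<close> would count the
  sum twice.\<close>

definition admissible :: "nat \<Rightarrow> nat \<Rightarrow> nat \<Rightarrow> bool" where
  "admissible p q s \<longleftrightarrow> p + q > 0 \<and> p + s > 1 \<and> q + s > 1 \<and> p + q + s > 2"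

text \<open>There are four minimal admissible triples, and for each of them the summand is at most
  \<open>(m n) powr - (3 / 2)\<close>.\<close>

lemma summable_tornheim:
  assumes "admissible p q s"
  shows "tornheim_term p q s summable_on UNIV"
proof -
  have bound: "real (Suc m) * sqrt (Suc m) * (real (Suc n) * sqrt (Suc n)) \<le> real (Suc m) ^ p * real (Suc n) ^ q * real (Suc m + Suc n) ^ s" for m n
  proof -
    \<comment> \<open>Square roots remove the half-integral exponents of the majorant, so that a
      polynomial inequality in \<open>x\<close> and \<open>y\<close> remains.\<close>
    define x y where xy: "x = sqrt (Suc m)" "y = sqrt (Suc n)"
    have ge: "x \<ge> 1" "y \<ge> 1" by (auto simp: xy)
    have sq: "real (Suc m) = x^2" "real (Suc n) = y^2" "real (Suc m + Suc n) = x^2 + y^2"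
      by (auto simp: xy)
    have mono: "(x^2)^p' * (y^2)^q' * (x^2+y^2)^s' \<le> (x^2)^p * (y^2)^q * (x^2+y^2)^s"
      if "p' \<le> p" "q' \<le> q" "s' \<le> s" for p' q' s'
    proof -
      have "x^2 \<ge> 1" "y^2 \<ge> 1" using ge by auto
      then show ?thesis
        using that by (intro mult_mono power_increasing) auto
    qed
    have am: "x * y \<le> x^2 + y^2"
      using sum_squares_bound[of x y] mult_nonneg_nonneg[of x y] ge by linarith
    consider "p \<ge> 1" "s \<ge> 2" | "q \<ge> 1" "s \<ge> 2" | "p \<ge> 1" "q \<ge> 1" "s \<ge> 1" | "p \<ge> 2" "q \<ge> 2"
      using assms unfolding admissible_def by linarith
    then have "x^2 * x * (y^2 * y) \<le> (x^2)^p * (y^2)^q * (x^2+y^2)^s"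
    proof cases
      case 1
      have "x^2 * x * (y^2 * y) = x^2 * ((x * y) * y^2)" by (simp add: power2_eq_square)
      also have "\<dots> \<le> x^2 * ((x^2+y^2) * (x^2 + y^2))"
        using am ge by (intro mult_left_mono mult_mono) auto
      also have "\<dots> \<le> (x^2)^p * (y^2)^q * (x^2+y^2)^s"
        using mono[of 1 0 2] 1 by (simp add: power2_eq_square)
      finally show ?thesis .
    next
      case 2
      have "x^2 * x * (y^2 * y) = y^2 * ((x * y) * x^2)" by (simp add: power2_eq_square)
      also have "\<dots> \<le> y^2 * ((x^2+y^2) * (x^2 + y^2))"
        using am ge by (intro mult_left_mono mult_mono) auto
      also have "\<dots> \<le> (x^2)^p * (y^2)^q * (x^2+y^2)^s"
        using mono[of 0 1 2] 2 by (simp add: power2_eq_square)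
      finally show ?thesis .
    next
      case 3
      have "x^2 * x * (y^2 * y) = x^2 * y^2 * (x * y)" by (simp add: mult_ac)
      also have "\<dots> \<le> x^2 * y^2 * (x^2 + y^2)"
        using am ge by (intro mult_left_mono) auto
      also have "\<dots> \<le> (x^2)^p * (y^2)^q * (x^2+y^2)^s"
        using mono[of 1 1 1] 3 by simp
      finally show ?thesis .
    next
      case 4
      have "x \<le> x^2" "y \<le> y^2" using ge by (auto simp: power2_eq_square)
      then have "x^2 * x * (y^2 * y) \<le> x^2 * x^2 * (y^2 * y^2)"
        using ge by (intro mult_left_mono mult_mono) auto
      also have "\<dots> \<le> (x^2)^p * (y^2)^q * (x^2+y^2)^s"
        using mono[of 2 2 0] 4 by (simp add: power2_eq_square)
      finally show ?thesis .
    qed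
    then show ?thesis
      unfolding xy[symmetric] unfolding sq by simp
  qed
  show ?thesis
  proof (rule summable_on_comparison_test[OF summable_product_powr])
    fix z :: "nat \<times> nat"
    obtain m n where z: "z = (m, n)" by force
    have "tornheim_term p q s z \<le> 1 / (real (Suc m) * sqrt (Suc m) * (real (Suc n) * sqrt (Suc n)))"
      unfolding z tornheim_term_def using bound[of m n]
      by (simp del: of_nat_Suc add: frac_le)
    then show "tornheim_term p q s z \<le> (case z of (m, n) \<Rightarrow> real (Suc m) powr (-3/2) * real (Suc n) powr (-3/2))"
      by (simp add: z powr_three_halves)
  qed (rule tornheim_term_nonneg)
qed

text \<open>Termwise this is \<open>1 / (x * y) = (1 / x + 1 / y) / (x + y)\<close>. It preserves
  the weight \<open>p + q + s\<close> and lowers \<open>p + q\<close>.\<close>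

lemma tornheim_rec:
  assumes "admissible (Suc p) (Suc q) s"
  shows "tornheim (Suc p) (Suc q) s = tornheim p (Suc q) (Suc s) + tornheim (Suc p) q (Suc s)"
proof -
  have adm: "admissible p (Suc q) (Suc s)" "admissible (Suc p) q (Suc s)"
    using assms by (auto simp: admissible_def)
  have "tornheim_term (Suc p) (Suc q) s z = tornheim_term p (Suc q) (Suc s) z + tornheim_term (Suc p) q (Suc s) z" for z
  proof -
    have "1 / (a * x * (b * y) * e) = 1 / (a * (b * y) * ((x + y) * e)) + 1 / (a * x * b * ((x + y) * e))"
      if "a > 0" "b > 0" "x > 0" "y > 0" "e > 0" for a b x y e :: real
    proof -
      define D where "D = a * x * (b * y) * e"
      have "x + y \<noteq> 0" using that by linarith
      then have "1 / D = x / (x + y) * (1 / D) + y / (x + y) * (1 / D)"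
        by (simp flip: distrib_right add_divide_distrib)
      then show ?thesis
        using that by (simp add: D_def mult_ac)
    qed
    from this[of "real (Suc (fst z)) ^ p" "real (Suc (snd z)) ^ q" "real (Suc (fst z))" "real (Suc (snd z))"
        "real (Suc (fst z) + Suc (snd z)) ^ s"]
    show ?thesis
      by (cases z) (simp add: tornheim_term_def mult_ac)
  qed
  then show ?thesis
    unfolding tornheim_def using infsum_add[OF adm[THEN summable_tornheim]] by presburger
qed

section \<open>Zeta values and their products as double sums\<close>

lemma has_sum_zeta:
  assumes "n \<ge> 2"
  shows "((\<lambda>k. 1 / real (Suc k) ^ n) has_sum zeta n) UNIV"
proof -
  have "summable (\<lambda>k. 1 / real (Suc k) ^ n)"
    using inverse_power_summable[OF assms, where 'a = real]
    by (simp add: summable_Suc_iff[of "\<lambda>k. 1 / real k ^ n"] field_simps del: of_nat_Suc)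
  then show ?thesis
    unfolding zeta_def by (intro sums_nonneg_imp_has_sum summable_sums) auto
qed

lemma tornheim_zero_right:
  assumes "p \<ge> 2" "q \<ge> 2"
  shows "tornheim p q 0 = zeta p * zeta q"
proof -
  have "admissible p q 0" using assms by (simp add: admissible_def)
  then have "(tornheim_term p q 0 has_sum tornheim p q 0) (UNIV \<times> UNIV)"
    unfolding tornheim_def using summable_tornheim by auto
  moreover have "((\<lambda>n. tornheim_term p q 0 (m, n)) has_sum 1 / real (Suc m) ^ p * zeta q) UNIV" for m
    using has_sum_cmult_right[OF has_sum_zeta[OF assms(2)], of "1 / real (Suc m) ^ p"]
    by (simp add: tornheim_term_def)
  ultimately have "((\<lambda>m. 1 / real (Suc m) ^ p * zeta q) has_sum tornheim p q 0) UNIV"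
    by (rule has_sum_SigmaD)
  moreover have "((\<lambda>m. 1 / real (Suc m) ^ p * zeta q) has_sum zeta p * zeta q) UNIV"
    by (intro has_sum_cmult_left has_sum_zeta assms)
  ultimately show ?thesis
    by (rule has_sum_unique)
qed

text \<open>The lattice points below the diagonal, on it, and above it give the three terms.\<close>

lemma tornheim_stuffle:
  assumes "p \<ge> 2" "q \<ge> 2"
  shows "zeta p * zeta q = tornheim 0 q p + tornheim 0 p q + zeta (p + q)"
proof -
  let ?f = "tornheim_term p q 0"
  have "admissible p q 0" "admissible 0 q p" "admissible 0 p q" using assms by (auto simp: admissible_def)
  note sm = this[THEN summable_tornheim]
  have "(tornheim_term 0 q p has_sum tornheim 0 q p) UNIV"
    unfolding tornheim_def using sm(2) by simp
  \<comment> \<open>Index \<open>k\<close> stands for the number \<open>k + 1\<close>, so the number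
    \<open>Suc m + Suc n\<close> has index \<open>Suc (m + n)\<close>.\<close>
  also have "?this \<longleftrightarrow> (?f has_sum tornheim 0 q p) {(m, n). n < m}"
    by (rule has_sum_reindex_bij_witness[of _ "\<lambda>(m, n). (m - Suc n, n)" "\<lambda>(m, n). (Suc (m + n), n)"])
      (auto simp: tornheim_term_def add_ac mult_ac)
  finally have below: "(?f has_sum tornheim 0 q p) {(m, n). n < m}" .
  have "(tornheim_term 0 p q has_sum tornheim 0 p q) UNIV"
    unfolding tornheim_def using sm(3) by simp
  also have "?this \<longleftrightarrow> (?f has_sum tornheim 0 p q) {(m, n). m < n}"
    by (rule has_sum_reindex_bij_witness[of _ "\<lambda>(m, n). (n - Suc m, m)" "\<lambda>(m, n). (n, Suc (m + n))"])
      (auto simp: tornheim_term_def add_ac mult_ac)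
  finally have above: "(?f has_sum tornheim 0 p q) {(m, n). m < n}" .
  have "((\<lambda>k. 1 / real (Suc k) ^ (p + q)) has_sum zeta (p + q)) UNIV"
    by (rule has_sum_zeta) (use assms in simp)
  also have "?this \<longleftrightarrow> (?f has_sum zeta (p + q)) {(m, n). m = n}"
    by (rule has_sum_reindex_bij_witness[of _ fst "\<lambda>k. (k, k)"])
      (auto simp: tornheim_term_def power_add)
  finally have diag: "(?f has_sum zeta (p + q)) {(m, n). m = n}" .
  have "(?f has_sum (tornheim 0 q p + tornheim 0 p q) + zeta (p + q))
      (({(m, n). n < m} \<union> {(m, n). m < n}) \<union> {(m, n). m = n})"
    by (intro has_sum_Un_disjoint below above diag) auto
  also have "({(m, n). n < m} \<union> {(m, n). m < n}) \<union> {(m, n). m = n} = (UNIV :: (nat \<times> nat) set)"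
    by auto
  finally have "(?f has_sum tornheim 0 q p + tornheim 0 p q + zeta (p + q)) UNIV" .
  then have "tornheim p q 0 = tornheim 0 q p + tornheim 0 p q + zeta (p + q)"
    unfolding tornheim_def[of p q 0] by (rule infsumI)
  then show ?thesis
    using tornheim_zero_right[OF assms] by simp
qed

text \<open>Each term is a difference of two reciprocals divided by \<open>n\<close>. The shift by
  \<open>n\<close> is built up in unit steps, each of which adds a telescoping series.\<close>

lemma harmonic_telescope:
  "((\<lambda>m. 1 / (real (Suc m) * real (Suc m + n))) has_sum (\<Sum>j<n. 1 / real (Suc j)) / real n) UNIV" if "n > 0"
proof -
  have "(\<lambda>m. 1 / real (Suc m) - 1 / real (Suc m + n)) sums (\<Sum>j<n. 1 / real (Suc j))"
  proof (induction n)
    case (Suc n)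
    have "(\<lambda>m. 1 / real (Suc m + n) - 1 / real (Suc (Suc m) + n)) sums (1 / real (Suc 0 + n) - 0)"
      by (rule telescope_sums') (use LIMSEQ_ignore_initial_segment[OF lim_1_over_n, of "Suc n"] in \<open>simp add: add_ac\<close>)
    from sums_add[OF Suc this] show ?case
      by (simp add: add_ac)
  qed simp
  from sums_divide[OF this, of "real n"]
  have "(\<lambda>m. 1 / (real (Suc m) * real (Suc m + n))) sums ((\<Sum>j<n. 1 / real (Suc j)) / real n)"
  proof (rule ssubst[of _ _ "\<lambda>f. f sums _", rotated], intro ext)
    fix m
    have "1 / (a * b) = (1 / a - 1 / b) / (b - a)" if "a > 0" "b > a" for a b :: real
      using that by (simp add: field_simps)
    from this[of "real (Suc m)" "real (Suc m + n)"] that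
    show "1 / (real (Suc m) * real (Suc m + n)) = (1 / real (Suc m) - 1 / real (Suc m + n)) / real n"
      by simp
  qed
  then show ?thesis
    by (rule sums_nonneg_imp_has_sum) simp
qed

text \<open>Summing over the first index gives a harmonic number, whose last term produces the zeta value.\<close>

lemma tornheim_one_one:
  assumes "q \<ge> 1"
  shows "tornheim 1 q 1 = zeta (q + 2) + tornheim 0 1 (q + 1)"
proof -
  have adm: "admissible 1 q 1" "admissible 0 1 (q + 1)" using assms by (auto simp: admissible_def)
  define H where "H = (\<lambda>n. \<Sum>j<n. 1 / real (Suc j))"
  have "(tornheim_term q 1 1 has_sum tornheim 1 q 1) (UNIV \<times> UNIV)"
    unfolding tornheim_commute[of 1] unfolding tornheim_def
    using summable_tornheim[OF adm(1)] by (simp add: summable_tornheim_swap[of q])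
  moreover have "((\<lambda>m. tornheim_term q 1 1 (n, m)) has_sum H (Suc n) / real (Suc n) ^ (q + 1)) UNIV" for n
    using has_sum_cmult_right[OF harmonic_telescope[of "Suc n"], of "1 / real (Suc n) ^ q"]
    by (simp add: tornheim_term_def H_def add_ac mult_ac)
  ultimately have lhs: "((\<lambda>n. H (Suc n) / real (Suc n) ^ (q + 1)) has_sum tornheim 1 q 1) UNIV"
    by (rule has_sum_SigmaD)
  \<comment> \<open>Grouped by its larger index, the double zeta value has numerators
    \<open>H n\<close>, one term short of the \<open>H (Suc n)\<close> found above.\<close>
  have "(tornheim_term 0 1 (q + 1) has_sum tornheim 0 1 (q + 1)) UNIV"
    unfolding tornheim_def using summable_tornheim[OF adm(2)] by simp
  also have "?this \<longleftrightarrow> ((\<lambda>(n, j). 1 / (real (Suc j) * real (Suc n) ^ (q + 1))) has_sum tornheim 0 1 (q + 1))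
      (Sigma UNIV (\<lambda>n. {..<n}))"
    by (rule has_sum_reindex_bij_witness[of _ "\<lambda>(n, j). (n - Suc j, j)" "\<lambda>(m, n). (Suc (m + n), n)"])
      (auto simp: tornheim_term_def)
  finally have "((\<lambda>n. H n / real (Suc n) ^ (q + 1)) has_sum tornheim 0 1 (q + 1)) UNIV"
    by (rule has_sum_SigmaD) (auto simp: H_def sum_divide_distrib mult_ac intro!: has_sum_finiteI)
  then have "((\<lambda>n. H n / real (Suc n) ^ (q + 1) + 1 / real (Suc n) ^ (q + 2)) has_sum tornheim 0 1 (q + 1) + zeta (q + 2)) UNIV"
    by (intro has_sum_add has_sum_zeta) auto
  moreover have "H n / real (Suc n) ^ (q + 1) + 1 / real (Suc n) ^ (q + 2) = H (Suc n) / real (Suc n) ^ (q + 1)" for n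
    by (simp add: H_def add_divide_distrib del: of_nat_Suc)
  ultimately show ?thesis
    using has_sum_unique[OF lhs] by simp
qed

section \<open>The integral as a Tornheim sum\<close>

text \<open>Repeated integration by parts of \<open>(- ln x) ^ r * x ^ (N - 1)\<close>; the sign
  keeps the integrand nonnegative on the unit interval.\<close>

fun log_power_antideriv :: "nat \<Rightarrow> nat \<Rightarrow> real \<Rightarrow> real" where
  "log_power_antideriv N 0 x = x ^ N / real N"
| "log_power_antideriv N (Suc r) x =
    (x ^ N * (- ln x) ^ Suc r + real (Suc r) * log_power_antideriv N r x) / real N"

lemma log_power_antideriv_deriv:
  assumes "x > 0" "N > 0"
  shows "(log_power_antideriv N r has_real_derivative (- ln x) ^ r * x ^ (N - 1)) (at x)"
proof (induction r)
  case 0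
  show ?case
    using assms by (auto intro!: derivative_eq_intros)
next
  case (Suc r)
  have "((\<lambda>x. x ^ N) has_real_derivative real N * x ^ (N - 1)) (at x)"
    using DERIV_pow[of N x] by simp
  moreover have "((\<lambda>x. - ln x) has_real_derivative - (1 / x)) (at x)"
    using assms by (auto intro!: derivative_eq_intros)
  then have "((\<lambda>x. (- ln x) ^ Suc r) has_real_derivative (1 + real r) * (- (1 / x) * (- ln x) ^ r)) (at x)"
    by (rule DERIV_power_Suc)
  ultimately have "((\<lambda>x. (x ^ N * (- ln x) ^ Suc r + real (Suc r) * log_power_antideriv N r x) / real N)
      has_real_derivative
      ((real N * x ^ (N - 1) * (- ln x) ^ Suc r + (1 + real r) * (- (1 / x) * (- ln x) ^ r) * x ^ N)
        + real (Suc r) * ((- ln x) ^ r * x ^ (N - 1))) / real N) (at x)"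
    by (intro DERIV_cdivide DERIV_add DERIV_mult DERIV_cmult Suc)
  also have "x ^ N = x * x ^ (N - 1)"
    using assms by (simp flip: power_Suc)
  also have "(real N * x ^ (N - 1) * (- ln x) ^ Suc r + (1 + real r) * (- (1 / x) * (- ln x) ^ r) * (x * x ^ (N - 1)))
        + real (Suc r) * ((- ln x) ^ r * x ^ (N - 1)) = real N * ((- ln x) ^ Suc r * x ^ (N - 1))"
    using assms by simp
  finally show ?case
    using assms by simp
qed

text \<open>Substituting \<open>y = - ln x\<close> turns one factor \<open>x\<close> into
  \<open>1 / exp y\<close>, which outweighs \<open>y ^ r\<close>.\<close>

lemma power_ln_tendsto_0:
  assumes "N > 0"
  shows "((\<lambda>x. x ^ N * (- ln x) ^ r) \<longlongrightarrow> 0) (at_right (0::real))"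
proof -
  have "((\<lambda>y :: real. y ^ r / exp y) \<longlongrightarrow> 0) at_top"
    by (rule tendsto_power_div_exp_0)
  moreover have "filterlim (\<lambda>x::real. - ln x) at_top (at_right 0)"
    by (intro filterlim_uminus_at_top_at_bot[THEN filterlim_compose] ln_at_0)
  ultimately have "((\<lambda>x. (- ln x) ^ r / exp (- ln x)) \<longlongrightarrow> 0) (at_right (0::real))"
    by (rule filterlim_compose)
  then have "((\<lambda>x. x ^ (N - 1) * ((- ln x) ^ r / exp (- ln x))) \<longlongrightarrow> 0 ^ (N - 1) * 0) (at_right (0::real))"
    by (intro tendsto_intros)
  moreover have "eventually (\<lambda>x. x ^ (N - 1) * ((- ln x) ^ r / exp (- ln x)) = x ^ N * (- ln x) ^ r) (at_right (0::real))"
    using eventually_at_right_less[of "0::real"]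
  proof eventually_elim
    case (elim x)
    then have "x ^ N = x ^ (N - 1) * x"
      using assms by (simp flip: power_Suc2)
    then show ?case
      using elim by (simp add: exp_minus field_simps)
  qed
  ultimately show ?thesis
    by (simp add: tendsto_cong)
qed

lemma log_power_antideriv_tendsto_0:
  assumes "N > 0"
  shows "(log_power_antideriv N r \<longlongrightarrow> 0) (at_right 0)"
proof (induction r)
  case 0
  have "((\<lambda>x. x ^ N / real N) \<longlongrightarrow> 0 ^ N / real N) (at_right (0::real))"
    using assms by (intro tendsto_intros) auto
  then show ?case
    using assms by (simp add: zero_power)
next
  case (Suc r)
  have "((\<lambda>x. (x ^ N * (- ln x) ^ Suc r + real (Suc r) * log_power_antideriv N r x) / real N)
     \<longlongrightarrow> (0 + real (Suc r) * 0) / real N) (at_right 0)"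
    using assms by (intro tendsto_intros Suc power_ln_tendsto_0) auto
  then show ?case by simp
qed

lemma log_power_antideriv_1: "N > 0 \<Longrightarrow> log_power_antideriv N r 1 = fact r / real N ^ Suc r"
  by (induction r) (auto simp: field_simps)

text \<open>The extended nonnegative form serves \<open>K_eq_tornheim\<close>, where sums and
  integral are interchanged without integrability conditions.\<close>

lemma nn_integral_log_power:
  assumes "N > 0"
  shows "(\<integral>\<^sup>+x. ennreal ((- ln x) ^ r * x ^ (N - 1)) * indicator {0<..<1} x \<partial>lborel)
      = ennreal (fact r / real N ^ Suc r)"
proof -
  let ?f = "\<lambda>x::real. (- ln x) ^ r * x ^ (N - 1)"
  let ?F = "log_power_antideriv N r"
  have lim1: "(?F \<longlongrightarrow> ?F 1) (at_left 1)"
    using log_power_antideriv_deriv[of 1 N r] assms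
    by (intro filterlim_mono[OF DERIV_isCont[unfolded isCont_def] order_refl at_le]) auto
  have "DERIV ?F x :> ?f x" if "0 < ereal x" for x
    using that assms by (intro log_power_antideriv_deriv) auto
  moreover have "isCont ?f x" if "0 < ereal x" for x
    using that by (intro continuous_intros) auto
  moreover have "AE x in lborel. 0 < ereal x \<longrightarrow> ereal x < 1 \<longrightarrow> 0 \<le> ?f x"
    by (intro AE_I2) auto
  moreover have "((?F \<circ> real_of_ereal) \<longlongrightarrow> 0) (at_right 0)"
    using log_power_antideriv_tendsto_0[OF assms]
    by (simp add: ereal_tendsto_simps zero_ereal_def)
  moreover have "((?F \<circ> real_of_ereal) \<longlongrightarrow> ?F 1) (at_left 1)"
    using lim1 by (simp add: ereal_tendsto_simps one_ereal_def)
  ultimately have int: "set_integrable lborel (einterval 0 1) ?f" "(LBINT x=0..1. ?f x) = ?F 1 - 0"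
    using interval_integral_FTC_nonneg[of 0 1 ?F ?f 0 "?F 1"] by simp_all
  have ei: "einterval 0 1 = {0<..<1::real}"
    by (auto simp: einterval_def zero_ereal_def one_ereal_def)
  have "(\<integral>\<^sup>+x. ennreal (?f x) * indicator {0<..<1} x \<partial>lborel)
      = (\<integral>\<^sup>+x. ennreal (indicator {0<..<1} x * ?f x) \<partial>lborel)"
    by (intro nn_integral_cong) (auto simp: indicator_def)
  also have "\<dots> = ennreal (integral\<^sup>L lborel (\<lambda>x. indicator {0<..<1} x * ?f x))"
    using int(1) by (intro nn_integral_eq_integral) (auto simp: set_integrable_def ei indicator_def)
  also have "integral\<^sup>L lborel (\<lambda>x. indicator {0<..<1} x * ?f x) = ?F 1"
    using int(2) by (simp add: interval_lebesgue_integral_def set_lebesgue_integral_def ei)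
  finally show ?thesis
    using log_power_antideriv_1[OF assms] by simp
qed

section \<open>Termwise integration of the polylogarithm series\<close>

lemma summable_polylog:
  assumes "0 < x" "x < 1"
  shows "summable (\<lambda>k. x ^ Suc k / real (Suc k) ^ p)"
proof (rule summable_comparison_test)
  show "\<exists>N. \<forall>k\<ge>N. norm (x ^ Suc k / real (Suc k) ^ p) \<le> x ^ Suc k"
    using assms by (auto simp: divide_le_eq simp del: of_nat_Suc power_Suc intro!: mult_left_mono[of 1, simplified])
  show "summable (\<lambda>k. x ^ Suc k)"
    using assms by (simp add: summable_Suc_iff summable_geometric)
qed

lemma ennreal_polylog:
  assumes "0 < x" "x < 1"
  shows "ennreal (polylog (int p) x) = (\<Sum>k. ennreal (x ^ Suc k / real (Suc k) ^ p))"
  unfolding polylog_def power_int_of_nat using summable_polylog[OF assms, of p] assms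
  by (intro suminf_ennreal2[symmetric]) auto

lemma ennreal_tornheim:
  assumes "admissible p q s"
  shows "(\<Sum>m n. ennreal (tornheim_term p q s (m, n))) = ennreal (tornheim p q s)"
proof -
  let ?g = "\<lambda>m. infsum (\<lambda>n. tornheim_term p q s (m, n)) UNIV"
  have sm: "tornheim_term p q s summable_on UNIV \<times> UNIV"
    using summable_tornheim[OF assms] by simp
  have row: "((\<lambda>n. tornheim_term p q s (m, n)) has_sum ?g m) UNIV" for m
    using summable_on_SigmaD1[of "\<lambda>m n. tornheim_term p q s (m, n)" UNIV "\<lambda>_. UNIV" m] sm
    by (intro has_sum_infsum) (simp add: case_prod_unfold)
  have "(tornheim_term p q s has_sum tornheim p q s) (UNIV \<times> UNIV)"
    unfolding tornheim_def using summable_tornheim[OF assms] by simp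
  then have "(?g has_sum tornheim p q s) UNIV"
    by (rule has_sum_SigmaD) (rule row)
  moreover have "?g m \<ge> 0" for m
    by (intro infsum_nonneg tornheim_term_nonneg)
  ultimately have "(\<Sum>m. ennreal (?g m)) = ennreal (tornheim p q s)"
    by (intro suminf_ennreal_eq has_sum_imp_sums)
  moreover have "(\<Sum>n. ennreal (tornheim_term p q s (m, n))) = ennreal (?g m)" for m
    by (intro suminf_ennreal_eq has_sum_imp_sums row tornheim_term_nonneg)
  ultimately show ?thesis by simp
qed

text \<open>With \<open>- ln x\<close> in place of \<open>ln x\<close> all terms of the expanded
  integrand are nonnegative, so monotone convergence permits termwise integration.\<close>

lemma K_eq_tornheim:
  assumes "p > 0 \<or> q > 0" "r \<ge> 1"
  shows "K r p q = (-1) ^ r * fact r * tornheim p q (Suc r)"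
proof -
  let ?A = "{0<..<1::real}"
  define f where "f = (\<lambda>x. (- ln x) ^ r * polylog (int p) x * polylog (int q) x / x * indicator ?A x)"
  define g where "g = (\<lambda>m n x. ennreal ((- ln x) ^ r * x ^ (Suc m + Suc n - 1)) * indicator ?A x *
      ennreal (1 / (real (Suc m) ^ p * real (Suc n) ^ q)))"
  have adm: "admissible p q (Suc r)"
    using assms by (auto simp: admissible_def)
  have polylog_nonneg: "polylog (int p) x \<ge> 0" if "0 < x" "x < 1" for p x
    unfolding polylog_def power_int_of_nat using that summable_polylog[of x p]
    by (intro suminf_nonneg) auto
  have f_eq: "ennreal (f x) = (\<Sum>m n. g m n x)" for x
  proof (cases "x \<in> ?A")
    case True
    then have x: "0 < x" "x < 1" by auto
    have "ennreal (f x) = ennreal ((- ln x) ^ r / x) * (ennreal (polylog (int p) x) * ennreal (polylog (int q) x))"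
      using x polylog_nonneg[OF x] by (simp add: f_def flip: ennreal_mult)
    also have "\<dots> = (\<Sum>m n. ennreal ((- ln x) ^ r / x) *
        (ennreal (x ^ Suc m / real (Suc m) ^ p) * ennreal (x ^ Suc n / real (Suc n) ^ q)))"
      unfolding ennreal_polylog[OF x] by (simp only: ennreal_suminf_cmult ennreal_suminf_multc)
    also have "\<dots> = (\<Sum>m n. g m n x)"
    proof (intro suminf_cong)
      fix m n
      have "ennreal ((- ln x) ^ r / x) * (ennreal (x ^ Suc m / real (Suc m) ^ p) * ennreal (x ^ Suc n / real (Suc n) ^ q))
          = ennreal ((- ln x) ^ r / x * (x ^ Suc m / real (Suc m) ^ p * (x ^ Suc n / real (Suc n) ^ q)))"
        using x by (subst ennreal_mult'', simp, subst ennreal_mult'') simp_all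
      also have "(- ln x) ^ r / x * (x ^ Suc m / real (Suc m) ^ p * (x ^ Suc n / real (Suc n) ^ q))
          = (- ln x) ^ r * x ^ (Suc m + Suc n - 1) * (1 / (real (Suc m) ^ p * real (Suc n) ^ q))"
        using x by (simp add: power_add del: of_nat_Suc)
      also have "ennreal \<dots> = g m n x"
        using True by (subst ennreal_mult'') (simp_all add: g_def)
      finally show "ennreal ((- ln x) ^ r / x) * (ennreal (x ^ Suc m / real (Suc m) ^ p) * ennreal (x ^ Suc n / real (Suc n) ^ q)) = g m n x" .
    qed
    finally show ?thesis .
  qed (simp add: f_def g_def)
  have meas_g [measurable]: "g m n \<in> borel_measurable lborel" for m n
    unfolding g_def by measurable
  have meas_f: "f \<in> borel_measurable lborel"
    unfolding f_def polylog_def by measurable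
  have f_nonneg: "f x \<ge> 0" for x
    using polylog_nonneg by (auto simp: f_def indicator_def)
  have "(\<integral>\<^sup>+x. ennreal (f x) \<partial>lborel) = (\<Sum>m n. \<integral>\<^sup>+x. g m n x \<partial>lborel)"
    unfolding f_eq by (subst nn_integral_suminf, measurable)+
  also have "\<dots> = (\<Sum>m n. ennreal (fact r) * ennreal (tornheim_term p q (Suc r) (m, n)))"
  proof (intro suminf_cong)
    fix m n
    have "(\<integral>\<^sup>+x. g m n x \<partial>lborel) = ennreal (fact r / real (Suc m + Suc n) ^ Suc r) *
        ennreal (1 / (real (Suc m) ^ p * real (Suc n) ^ q))"
      unfolding g_def by (subst nn_integral_multc) (measurable, subst nn_integral_log_power, auto)
    then show "(\<integral>\<^sup>+x. g m n x \<partial>lborel) = ennreal (fact r) * ennreal (tornheim_term p q (Suc r) (m, n))"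
      by (simp add: tornheim_term_def mult_ac del: of_nat_Suc power_Suc of_nat_add flip: ennreal_mult)
  qed
  also have "\<dots> = ennreal (fact r) * ennreal (tornheim p q (Suc r))"
    using ennreal_tornheim[OF adm] by simp
  also have "\<dots> = ennreal (fact r * tornheim p q (Suc r))"
    by (rule ennreal_mult'[symmetric]) simp
  finally have "(\<integral>\<^sup>+x. ennreal (f x) \<partial>lborel) = ennreal (fact r * tornheim p q (Suc r))" .
  moreover have "tornheim p q (Suc r) \<ge> 0"
    unfolding tornheim_def by (intro infsum_nonneg tornheim_term_nonneg)
  ultimately have "integral\<^sup>L lborel f = fact r * tornheim p q (Suc r)"
    using meas_f f_nonneg by (subst integral_eq_nn_integral) auto
  moreover have "K r p q = integral\<^sup>L lborel (\<lambda>x. (-1) ^ r * f x)"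
    unfolding K_def set_lebesgue_integral_def
  proof (intro Bochner_Integration.integral_cong refl)
    fix x :: real
    have "ln x ^ r = (-1) ^ r * (- ln x) ^ r"
      by (simp flip: power_mult_distrib)
    then show "indicator ?A x *\<^sub>R (ln x ^ r * polylog (int p) x * polylog (int q) x / x) = (-1) ^ r * f x"
      by (simp add: f_def mult_ac)
  qed
  ultimately show ?thesis by simp
qed

section \<open>Polynomials with double shuffle symmetry\<close>

text \<open>Reversing a coefficient sequence of length \<open>d + 1\<close> corresponds to the
  substitution \<open>1 / t\<close>, up to the factor \<open>t ^ d\<close>.\<close>

lemma antisymmetric_coeffs_eval:
  fixes c :: "nat \<Rightarrow> real"
  assumes "\<And>i. i \<le> d \<Longrightarrow> c (d - i) = - c i" "t \<noteq> 0"
  shows "t ^ d * (\<Sum>i\<le>d. c i * (1 / t) ^ i) = - (\<Sum>i\<le>d. c i * t ^ i)"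
proof -
  have "t ^ d * (\<Sum>i\<le>d. c i * (1 / t) ^ i) = (\<Sum>i\<le>d. c i * t ^ (d - i))"
    using assms(2) by (auto simp: sum_distrib_left power_diff power_divide intro!: sum.cong)
  also have "\<dots> = (\<Sum>i\<le>d. c (d - i) * t ^ i)"
    by (rule sum.reindex_bij_witness[of _ "\<lambda>i. d - i" "\<lambda>i. d - i"]) auto
  also have "\<dots> = (\<Sum>i\<le>d. - (c i * t ^ i))"
    using assms(1) by (intro sum.cong) auto
  finally show ?thesis
    by (simp add: sum_negf)
qed

text \<open>The binomial theorem; it reads the binomial sums of the shuffle relation as coefficients
  after the substitution \<open>t = 1 + u\<close>.\<close>

lemma binomial_transform_eval:
  fixes c :: "nat \<Rightarrow> real"
  shows "(\<Sum>j\<le>d. (\<Sum>e\<le>d. real (e choose j) * c e) * u ^ j) = (\<Sum>e\<le>d. c e * (1 + u) ^ e)"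
proof -
  have "(1 + u) ^ e = (\<Sum>j\<le>d. real (e choose j) * u ^ j)" if "e \<le> d" for e
  proof -
    have "(1 + u) ^ e = (\<Sum>j\<le>e. real (e choose j) * u ^ j)"
      using binomial_ring[of u 1 e] by (simp add: add.commute)
    also have "\<dots> = (\<Sum>j\<le>d. real (e choose j) * u ^ j)"
      using that by (intro sum.mono_neutral_left) (auto simp: binomial_eq_0)
    finally show ?thesis .
  qed
  then have "(\<Sum>e\<le>d. c e * (1 + u) ^ e) = (\<Sum>e\<le>d. \<Sum>j\<le>d. real (e choose j) * c e * u ^ j)"
    by (simp add: sum_distrib_left mult_ac)
  then show ?thesis
    by (subst (asm) sum.swap) (simp add: sum_distrib_right)
qed

text \<open>Modulo products, the generating polynomial of the double zeta values of weight \<open>d + 2\<close> is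
  anti-invariant under a dihedral group of order 12, generated (in dehomogenised form) by
  \<open>t \<mapsto> 1 / t\<close> and \<open>t \<mapsto> 1 - t\<close>.\<close>

locale double_shuffle_coeffs =
  fixes c :: "nat \<Rightarrow> real" and d :: nat
  assumes stuffle: "\<And>i. i \<le> d \<Longrightarrow> c (d - i) = - c i"
  assumes shuffle: "\<And>i. i \<le> d \<Longrightarrow> (\<Sum>e\<le>d. real ((e choose i) + (e choose (d - i))) * c e) = 0"
begin

definition gen :: "real poly" where
  "gen = (\<Sum>i\<le>d. monom (c i) i)"

lemma coeff_gen: "coeff gen i = (if i \<le> d then c i else 0)"
  by (simp add: gen_def coeff_sum)

lemma poly_gen: "poly gen t = (\<Sum>i\<le>d. c i * t ^ i)"
  by (simp add: gen_def poly_sum poly_monom)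

lemma gen_inverse: "t \<noteq> 0 \<Longrightarrow> t ^ d * poly gen (1 / t) = - poly gen t"
  unfolding poly_gen using stuffle by (rule antisymmetric_coeffs_eval)

text \<open>The shuffle relation says that the coefficients of \<open>gen\<close> in powers of
  \<open>u\<close>, where \<open>t = 1 + u\<close>, are antisymmetric.\<close>

lemma gen_shift_inverse:
  assumes "u \<noteq> 0"
  shows "u ^ d * poly gen (1 + 1 / u) = - poly gen (1 + u)"
proof -
  define b where "b = (\<lambda>j. \<Sum>e\<le>d. real (e choose j) * c e)"
  have "b (d - i) = - b i" if "i \<le> d" for i
    using shuffle[OF that] by (simp add: b_def sum.distrib algebra_simps)
  from antisymmetric_coeffs_eval[of d b, OF this assms] show ?thesis
    unfolding b_def poly_gen binomial_transform_eval by simp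
qed

text \<open>The chain \<open>s\<close>, \<open>1 / s = 1 + u\<close>,
  \<open>1 + 1 / u = 1 / (1 - s)\<close>, \<open>1 - s\<close> uses the inversion, the shifted
  inversion and the inversion again, hence three changes of sign.\<close>

lemma gen_reflect_generic:
  assumes "s \<noteq> 0" "s \<noteq> 1"
  shows "poly gen (1 - s) = - poly gen s"
proof -
  define u where "u = 1 / s - 1"
  have u: "u \<noteq> 0" "1 + u = 1 / s" "1 + 1 / u = 1 / (1 - s)" "u * s = 1 - s"
    using assms by (auto simp: u_def field_simps)
  have "poly gen s = - (s ^ d * poly gen (1 / s))"
    using gen_inverse[OF assms(1)] by simp
  also have "\<dots> = (u * s) ^ d * poly gen (1 / (1 - s))"
    using gen_shift_inverse[OF u(1)] unfolding u(2,3) by (simp add: power_mult_distrib mult_ac)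
  also have "\<dots> = - poly gen (1 - s)"
    using gen_inverse[of "1 - s"] assms u by simp
  finally show ?thesis by simp
qed

lemma gen_reflect: "poly gen (1 - s) = - poly gen s"
proof -
  have "pcompose gen [:1, -1:] + gen = 0"
  proof (rule ccontr)
    assume "pcompose gen [:1, -1:] + gen \<noteq> 0"
    then have "finite {s. poly (pcompose gen [:1, -1:] + gen) s = 0}"
      by (rule poly_roots_finite)
    moreover have "UNIV - {0, 1} \<subseteq> {s. poly (pcompose gen [:1, -1:] + gen) s = 0}"
      using gen_reflect_generic by (auto simp: poly_pcompose)
    ultimately have "finite (UNIV - {0, 1 :: real})"
      using finite_subset by blast
    then show False
      by (simp add: infinite_UNIV_char_0)
  qed
  then have "poly (pcompose gen [:1, -1:] + gen) s = 0" by simp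
  then show ?thesis by (simp add: poly_pcompose)
qed

lemma gen_rotate:
  assumes "t \<noteq> 1"
  shows "poly gen t = (1 - t) ^ d * poly gen (1 / (1 - t))"
  using gen_reflect[of t] gen_inverse[of "1 - t"] assms by simp

text \<open>This involution fixes 0 and exchanges 1 with infinity; it decides the parity of the
  order of vanishing at 0.\<close>

lemma gen_reflect_fixing_0:
  assumes "t \<noteq> 1"
  shows "poly gen t = - ((1 - t) ^ d * poly gen (- t / (1 - t)))"
proof -
  have "1 / (1 - t) = 1 - (- t / (1 - t))"
    using assms by (simp add: divide_simps)
  then have "poly gen (1 / (1 - t)) = - poly gen (- t / (1 - t))"
    by (metis gen_reflect)
  then show ?thesis
    using gen_rotate[OF assms] by simp
qed

text \<open>The cube of the rotation is \<open>-1\<close> on homogeneous polynomials in two variables.\<close>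

lemma gen_eq_0_if_odd:
  assumes "odd d"
  shows "gen = 0"
proof (rule ccontr)
  assume "gen \<noteq> 0"
  then have fin: "finite {t. poly gen t = 0}"
    by (rule poly_roots_finite)
  have "poly gen t = 0" if "t \<noteq> 0" "t \<noteq> 1" for t
  proof -
    define t' where "t' = 1 / (1 - t)"
    define t'' where "t'' = 1 / (1 - t')"
    have t: "t' \<noteq> 1" "t'' \<noteq> 1" "1 / (1 - t'') = t" "(1 - t) * (1 - t') * (1 - t'') = -1"
      using that by (auto simp: t'_def t''_def divide_simps)
    have "poly gen t = ((1 - t) * (1 - t') * (1 - t'')) ^ d * poly gen t"
      using gen_rotate[OF that(2)] gen_rotate[OF t(1)] gen_rotate[OF t(2)]
      by (simp only: t(3) power_mult_distrib mult_ac flip: t'_def t''_def)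
    then show ?thesis
      using assms by (simp add: t(4))
  qed
  then have "UNIV - {0, 1} \<subseteq> {t. poly gen t = 0}" by auto
  with fin have "finite (UNIV - {0, 1 :: real})"
    using finite_subset by blast
  then show False
    by (simp add: infinite_UNIV_char_0)
qed

section \<open>The order of vanishing at 0\<close>

lemma order_gen_le:
  assumes "gen \<noteq> 0"
  shows "order 0 gen \<le> d"
proof -
  have "degree gen \<le> d"
    by (rule degree_le) (simp add: coeff_gen)
  with order_degree[OF assms, of 0] show ?thesis
    by (rule order_trans)
qed

text \<open>To first order at 0 the involution of \<open>gen_reflect_fixing_0\<close> is
  \<open>- t\<close>, so it multiplies the lowest term, of degree \<open>m\<close>, by
  \<open>(-1) ^ m\<close>. Anti-invariance forces this sign to be \<open>-1\<close>.\<close>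

lemma order_gen_odd:
  assumes "even d" "gen \<noteq> 0"
  shows "odd (order 0 gen)"
proof -
  define m where "m = order 0 gen"
  obtain g where g: "gen = [:0, 1:] ^ m * g" and "\<not> [:0, 1:] dvd g"
    using order_decomp[OF assms(2), of 0] by (auto simp: m_def)
  then have g0: "poly g 0 \<noteq> 0"
    using poly_eq_0_iff_dvd[of g 0] by simp
  have m: "m \<le> d"
    using order_gen_le[OF assms(2)] by (simp add: m_def)
  have eq: "poly g t = - ((-1) ^ m * (1 - t) ^ (d - m) * poly g (- t / (1 - t)))"
    if "t \<noteq> 0" "t \<noteq> 1" for t
  proof -
    have "t ^ m * poly g t = - ((1 - t) ^ d * ((- t / (1 - t)) ^ m * poly g (- t / (1 - t))))"
      using gen_reflect_fixing_0[OF that(2)] by (simp add: g)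
    also have "(1 - t) ^ d = (1 - t) ^ (d - m) * (1 - t) ^ m"
      using m by (simp flip: power_add)
    also have "\<dots> * ((- t / (1 - t)) ^ m * poly g (- t / (1 - t)))
        = (1 - t) ^ (d - m) * ((1 - t) * (- t / (1 - t))) ^ m * poly g (- t / (1 - t))"
      by (simp only: power_mult_distrib mult_ac)
    also have "(1 - t) * (- t / (1 - t)) = (-1) * t"
      using that by simp
    also have "((-1) * t) ^ m = (-1) ^ m * t ^ m"
      by (rule power_mult_distrib)
    finally have "t ^ m * poly g t = t ^ m * - ((-1) ^ m * (1 - t) ^ (d - m) * poly g (- t / (1 - t)))"
      by simp
    then show ?thesis
      using that(1) mult_left_cancel[of "t ^ m"] by (metis power_not_zero)
  qed
  \<comment> \<open>The identity \<open>eq\<close> came from cancelling \<open>t ^ m\<close>, so its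
    instance at 0 is recovered as a limit.\<close>
  define h where "h = (\<lambda>t. - ((-1) ^ m * (1 - t) ^ (d - m) * poly g (- t / (1 - t))))"
  have "(h \<longlongrightarrow> - ((-1) ^ m * (1 - 0) ^ (d - m) * poly g (- 0 / (1 - 0)))) (at 0)"
    unfolding h_def by (intro tendsto_intros) auto
  moreover have "eventually (\<lambda>t. h t = poly g t) (at 0)"
    unfolding eventually_at by (rule exI[of _ 1]) (use eq in \<open>auto simp: h_def\<close>)
  ultimately have "(poly g \<longlongrightarrow> - ((-1) ^ m * poly g 0)) (at 0)"
    by (simp add: tendsto_cong)
  moreover have "(poly g \<longlongrightarrow> poly g 0) (at 0)"
    by (intro tendsto_intros)
  ultimately have "poly g 0 = - ((-1) ^ m * poly g 0)"
    by (intro tendsto_unique[of "at 0"]) auto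
  with g0 show ?thesis
    unfolding m_def[symmetric] by (cases "even m") auto
qed

text \<open>By symmetry the order of vanishing at 0 is also the order at 1 and at infinity; the
  remaining three reflections give the simple zeros \<open>-1\<close>, \<open>1 / 2\<close> and \<open>2\<close>.\<close>

lemma order_gen_bound:
  assumes "gen \<noteq> 0"
  shows "3 * order 0 gen + 3 \<le> d"
proof -
  define m where "m = order 0 gen"
  obtain g where g: "gen = [:0, 1:] ^ m * g"
    using order_1[of 0 gen] by (auto simp: m_def dvd_def)
  have low: "c i = 0" if "i < m" "i \<le> d" for i
  proof -
    have "coeff gen i = coeff (monom 1 m * g) i"
      by (simp add: g monom_altdef)
    then show ?thesis
      using that by (simp add: coeff_gen coeff_monom_mult)
  qed
  have "gen = [:1, -1:] ^ m * pcompose (- g) [:1, -1:]"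
  proof (rule poly_eq_poly_eq_iff[THEN iffD1], rule ext)
    fix s show "poly gen s = poly ([:1, -1:] ^ m * pcompose (- g) [:1, -1:]) s"
      using gen_reflect[of s] by (simp add: g poly_pcompose)
  qed
  moreover have "[:-1, 1:] ^ m dvd [:1, -1:: real:] ^ m"
    by (rule dvd_power_same) (auto intro: dvdI[of _ _ "-1"])
  ultimately have "[:-1, 1:] ^ m dvd gen"
    by (metis dvd_mult2)
  then have "m \<le> order 1 gen"
    using assms by (simp add: order_divides)
  also have "order 1 gen = order 1 g"
    using assms g by (subst g, subst order_mult) (auto simp: order_eq_0_iff)
  finally have "[:-1, 1:] ^ m dvd g"
    by (simp add: order_divides)
  then obtain h where h: "g = [:-1, 1:] ^ m * h" ..
  have gen_h: "gen = [:0, 1:] ^ m * [:-1, 1:] ^ m * h"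
    by (simp add: g h)
  with assms have h0: "h \<noteq> 0" by auto
  \<comment> \<open>The bound results from
    \<open>2 * m + 3 \<le> degree gen \<le> d - m\<close>.\<close>
  have "degree gen = m + m + degree h"
    unfolding gen_h using h0 by (simp add: degree_mult_eq degree_power_eq)
  \<comment> \<open>Vanishing at infinity: by antisymmetry the top \<open>m\<close> coefficients are
    the negatives of the bottom \<open>m\<close>.\<close>
  moreover have "degree gen \<le> d - m"
  proof (rule degree_le, safe)
    fix i assume "i > d - m"
    then show "coeff gen i = 0"
      using stuffle[of "d - i"] low[of "d - i"] by (cases "i \<le> d") (auto simp: coeff_gen)
  qed
  moreover have "3 \<le> degree h"
  proof -
    have half: "poly gen (1/2) = 0"
      using gen_reflect[of "1/2"] by simp
    \<comment> \<open>The point \<open>-1\<close> is fixed by inversion, and \<open>d\<close> is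
      even because \<open>gen\<close> is nonzero.\<close>
    have neg: "poly gen (-1) = 0"
      using gen_inverse[of "-1"] assms gen_eq_0_if_odd by (cases "even d") auto
    have two: "poly gen 2 = 0"
      using gen_reflect[of 2] neg by simp
    have "{-1, 1/2, 2} \<subseteq> {x. poly h x = 0}"
      using half neg two by (auto simp: gen_h)
    then have "card {-1, 1/2, 2 :: real} \<le> card {x. poly h x = 0}"
      using h0 by (intro card_mono poly_roots_finite)
    also have "\<dots> \<le> degree h"
      using h0 by (rule card_poly_roots_bound)
    finally show ?thesis by simp
  qed
  moreover have "m \<le> d"
    using order_gen_le[OF assms] by (simp add: m_def)
  ultimately show ?thesis
    unfolding m_def by linarith
qed

lemma coeffs_eq_0_if_odd: "odd d \<Longrightarrow> i \<le> d \<Longrightarrow> c i = 0"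
  using gen_eq_0_if_odd coeff_gen[of i] by simp

text \<open>If \<open>gen\<close> were nonzero, its order would be some
  \<open>m = 2 * j - 1\<close>, and \<open>3 * m + 3 \<le> d\<close> reads
  \<open>6 * j \<le> d\<close>. Its lowest coefficient would then be among those assumed to be
  0.\<close>

lemma coeffs_eq_0_if_low_odd_coeffs:
  assumes "even d" and "\<And>j. 1 \<le> j \<Longrightarrow> j \<le> d div 6 \<Longrightarrow> c (2 * j - 1) = 0" and "i \<le> d"
  shows "c i = 0"
proof -
  have "gen = 0"
  proof (rule ccontr)
    assume "gen \<noteq> 0"
    define m where "m = order 0 gen"
    have m: "odd m" "3 * m + 3 \<le> d"
      using order_gen_odd order_gen_bound \<open>gen \<noteq> 0\<close> assms(1) by (auto simp: m_def)
    then obtain j where j: "m = 2 * j - 1" "j \<ge> 1"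
      by (metis Suc_eq_plus1 add_diff_cancel_right' mult_2 oddE le_add2 add_Suc add_Suc_right diff_Suc_Suc minus_nat.diff_0)
    have "c m = 0"
      using assms(2)[of j] m j by simp
    obtain g where g: "gen = [:0, 1:] ^ m * g" and "\<not> [:0, 1:] dvd g"
      using order_decomp[OF \<open>gen \<noteq> 0\<close>, of 0] by (auto simp: m_def)
    then have "poly g 0 \<noteq> 0"
      using poly_eq_0_iff_dvd[of g 0] by simp
    moreover have "coeff gen m = coeff (monom 1 m * g) m"
      by (simp add: g monom_altdef)
    then have "c m = poly g 0"
      using m by (simp add: coeff_gen coeff_monom_mult poly_0_coeff_0)
    ultimately show False
      using \<open>c m = 0\<close> by simp
  qed
  then show ?thesis
    using assms(3) coeff_gen[of i] by simp
qed

end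

section \<open>Functionals vanishing on zeta products\<close>

text \<open>Partial fractions split \<open>1 / (x ^ p * y ^ q)\<close> into terms in
  \<open>y\<close> and \<open>x + y\<close> and terms in \<open>x\<close> and \<open>x + y\<close>;
  this collects the first kind. Binomials with \<open>e < p - 1\<close> are 0, which lets the range
  depend on \<open>p + q\<close> only.\<close>

definition shuffle_part :: "nat \<Rightarrow> nat \<Rightarrow> nat \<Rightarrow> real" where
  "shuffle_part p q s = (if p = 0 then tornheim 0 q s
     else \<Sum>e<p + q - 1. real (e choose (p - 1)) * tornheim 0 (p + q - 1 - e) (s + 1 + e))"

text \<open>Pascal's rule for the binomial coefficients; for \<open>p = 0\<close> the term
  \<open>e = 0\<close> splits off.\<close>

lemma shuffle_part_rec:
  "shuffle_part (Suc p) (Suc q) s = shuffle_part p (Suc q) (Suc s) + shuffle_part (Suc p) q (Suc s)"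
proof (cases p)
  case 0
  then show ?thesis
    by (simp add: shuffle_part_def sum.lessThan_Suc_shift del: sum.lessThan_Suc)
next
  case (Suc p')
  then show ?thesis
    by (simp add: shuffle_part_def sum.lessThan_Suc_shift sum.distrib algebra_simps del: sum.lessThan_Suc)
qed

lemma shuffle_part_0_right: "q > 0 \<Longrightarrow> shuffle_part q 0 s = 0"
  by (auto simp: shuffle_part_def binomial_eq_0)

text \<open>Both sides obey the same recursion, by \<open>tornheim_rec\<close> and
  \<open>shuffle_part_rec\<close>, and agree once \<open>p\<close> or \<open>q\<close> is 0.\<close>

lemma tornheim_eq_shuffle_parts:
  assumes "admissible p q s"
  shows "tornheim p q s = shuffle_part p q s + shuffle_part q p s"
  using assms
proof (induction "p + q" arbitrary: p q s rule: less_induct)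
  case less
  consider "p = 0" "q > 0" | "q = 0" "p > 0" | p' q' where "p = Suc p'" "q = Suc q'"
    using less.prems by (cases p; cases q) (auto simp: admissible_def)
  then show ?case
  proof cases
    case 1
    then show ?thesis by (simp add: shuffle_part_0_right) (simp add: shuffle_part_def)
  next
    case 2
    then show ?thesis
      by (simp add: shuffle_part_0_right tornheim_commute[of p]) (simp add: shuffle_part_def)
  next
    case 3
    have "admissible p' q (Suc s)" "admissible p q' (Suc s)"
      using less.prems 3 by (auto simp: admissible_def)
    then have "tornheim p' q (Suc s) = shuffle_part p' q (Suc s) + shuffle_part q p' (Suc s)"
      "tornheim p q' (Suc s) = shuffle_part p q' (Suc s) + shuffle_part q' p (Suc s)"
      using less.hyps 3 by auto
    then show ?thesis
      using tornheim_rec[of p' q' s] less.prems 3 by (simp add: shuffle_part_rec)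
  qed
qed

text \<open>Euler's sum formula for double zeta values: \<open>tornheim 1 d 1\<close> is evaluated
  by partial fractions and by harmonic numbers, and \<open>tornheim 0 1 (d + 1)\<close>
  cancels.\<close>

lemma tornheim_sum_formula:
  assumes "d \<ge> 1"
  shows "(\<Sum>e<d. tornheim 0 (d - e) (e + 2)) = zeta (d + 2)"
proof -
  have "shuffle_part 1 d 1 = (\<Sum>e<d. tornheim 0 (d - e) (e + 2))"
    by (simp add: shuffle_part_def)
  moreover have "shuffle_part d 1 1 = tornheim 0 1 (d + 1)"
  proof -
    obtain d' where d: "d = Suc d'"
      using assms by (cases d) auto
    have "shuffle_part d 1 1 = (\<Sum>e<Suc d'. real (e choose d') * tornheim 0 (Suc d' - e) (2 + e))"
      by (simp add: shuffle_part_def d)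
    also have "\<dots> = tornheim 0 1 (d + 1)"
      by (simp add: binomial_eq_0 d)
    finally show ?thesis .
  qed
  moreover have "admissible 1 d 1"
    using assms by (simp add: admissible_def)
  ultimately show ?thesis
    using tornheim_eq_shuffle_parts[of 1 d 1] tornheim_one_one[OF assms] by simp
qed

section \<open>Double shuffle relations modulo zeta products\<close>

locale zeta_product_functional =
  fixes \<phi> :: "real \<Rightarrow> real"
  assumes add: "\<phi> (x + y) = \<phi> x + \<phi> y"
    and scale: "\<phi> (of_rat c * x) = of_rat c * \<phi> x"
    and zeta_products: "x \<in> zeta_products \<Longrightarrow> \<phi> x = 0"
begin

lemma zero: "\<phi> 0 = 0"
  using add[of 0 0] by simp

lemma of_nat_scale: "\<phi> (real n * x) = real n * \<phi> x"
  using scale[of "of_nat n" x] by simp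

lemma sum: "\<phi> (sum f A) = (\<Sum>x\<in>A. \<phi> (f x))"
  by (induction A rule: infinite_finite_induct) (simp_all add: add zero)

lemma zeta: "n \<ge> 2 \<Longrightarrow> \<phi> (zeta n) = 0"
  by (rule zeta_products) (auto simp: zeta_products_def intro!: exI[of _ "[n]"])

lemma zeta_mult_zeta: "m \<ge> 2 \<Longrightarrow> n \<ge> 2 \<Longrightarrow> \<phi> (zeta m * zeta n) = 0"
  by (rule zeta_products) (auto simp: zeta_products_def intro!: exI[of _ "[m, n]"])

text \<open>The coefficient at 0 stands for the divergent double zeta value of exponents \<open>(1, d + 1)\<close>;
  it is chosen such that the stuffle relation holds.\<close>

definition dz_coeff :: "nat \<Rightarrow> nat \<Rightarrow> real" where
  "dz_coeff d e = (if e = 0 then - \<phi> (tornheim 0 1 (d + 1)) else \<phi> (tornheim 0 (d + 1 - e) (e + 1)))"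

text \<open>Inside the range \<open>\<phi>\<close> kills the product and the single zeta value in
  \<open>tornheim_stuffle\<close>; at the ends the choice of the coefficient at 0 decides.\<close>

lemma dz_coeff_stuffle:
  assumes "d \<ge> 1" "i \<le> d"
  shows "dz_coeff d (d - i) = - dz_coeff d i"
proof -
  consider "i = 0" | "i = d" | "0 < i" "i < d"
    using assms by linarith
  then show ?thesis
  proof cases
    case 3
    then have "\<phi> (tornheim 0 (d - i + 1) (i + 1)) + \<phi> (tornheim 0 (i + 1) (d - i + 1)) = 0"
      using tornheim_stuffle[of "i + 1" "d - i + 1"] zeta_mult_zeta[of "i + 1" "d - i + 1"] zeta[of "i + 1 + (d - i + 1)"]
      by (simp add: add)
    moreover have "d + 1 - i = d - i + 1" "d + 1 - (d - i) = i + 1"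
      using 3 by auto
    ultimately show ?thesis
      using 3 by (simp add: dz_coeff_def)
  qed (use assms in \<open>simp_all add: dz_coeff_def\<close>)
qed

lemma dz_coeff_shuffle_part:
  assumes "0 < i" "i < d"
  shows "\<phi> (shuffle_part (i + 1) (d - i + 1) 0) = (\<Sum>e\<le>d. real (e choose i) * dz_coeff d e)"
proof -
  have "\<phi> (shuffle_part (i + 1) (d - i + 1) 0) = (\<Sum>e<d + 1. real (e choose i) * \<phi> (tornheim 0 (d + 1 - e) (e + 1)))"
    using assms by (simp add: shuffle_part_def sum of_nat_scale del: sum.lessThan_Suc)
  \<comment> \<open>At \<open>e = 0\<close> the left side contains the divergent
    \<open>tornheim 0 (d + 1) 1\<close>, but its binomial coefficient is 0 since
    \<open>i > 0\<close>.\<close>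
  also have "\<dots> = (\<Sum>e\<le>d. real (e choose i) * dz_coeff d e)"
    using assms by (intro sum.cong) (auto simp: dz_coeff_def)
  finally show ?thesis .
qed

text \<open>This is the shuffle relation for \<open>i = 0\<close> and \<open>i = d\<close>; the sum
  formula replaces the divergent product of \<open>zeta 1\<close> and
  \<open>zeta (d + 1)\<close>.\<close>

lemma dz_coeff_sum:
  assumes "d \<ge> 1"
  shows "(\<Sum>e\<le>d. dz_coeff d e) + dz_coeff d d = 0"
proof -
  have "(\<Sum>e\<le>d. dz_coeff d e) = dz_coeff d 0 + (\<Sum>e<d. dz_coeff d (Suc e))"
    by (simp add: sum.lessThan_Suc_shift flip: lessThan_Suc_atMost del: sum.lessThan_Suc)
  also have "(\<Sum>e<d. dz_coeff d (Suc e)) = \<phi> (\<Sum>e<d. tornheim 0 (d - e) (e + 2))"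
    by (simp add: sum dz_coeff_def)
  also have "\<dots> = 0"
    using tornheim_sum_formula[OF assms] zeta[of "d + 2"] by simp
  also have "dz_coeff d 0 = - dz_coeff d d"
    using assms by (simp add: dz_coeff_def)
  finally show ?thesis by simp
qed

text \<open>For \<open>0 < i < d\<close> the product of \<open>zeta (i + 1)\<close> and
  \<open>zeta (d - i + 1)\<close> is a Tornheim sum with \<open>s = 0\<close>; its partial fraction
  expansion is killed by \<open>\<phi>\<close>.\<close>

lemma dz_coeff_shuffle:
  assumes "d \<ge> 1" "i \<le> d"
  shows "(\<Sum>e\<le>d. real ((e choose i) + (e choose (d - i))) * dz_coeff d e) = 0"
proof -
  have choose_d: "(\<Sum>e\<le>d. real (e choose d) * dz_coeff d e) = dz_coeff d d"
    by (subst sum.remove[of _ d]) (auto simp: binomial_eq_0 intro!: sum.neutral)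
  consider "i = 0" | "i = d" | "0 < i" "i < d"
    using assms by linarith
  then show ?thesis
  proof cases
    case 3
    have "\<phi> (shuffle_part (i + 1) (d - i + 1) 0) + \<phi> (shuffle_part (d - i + 1) (i + 1) 0)
        = \<phi> (zeta (i + 1) * zeta (d - i + 1))"
      using 3 tornheim_eq_shuffle_parts[of "i + 1" "d - i + 1" 0] tornheim_zero_right[of "i + 1" "d - i + 1"]
      by (simp add: admissible_def Suc_le_eq flip: add)
    then have "\<phi> (shuffle_part (i + 1) (d - i + 1) 0) + \<phi> (shuffle_part (d - i + 1) (i + 1) 0) = 0"
      using 3 zeta_mult_zeta by simp
    then show ?thesis
      using dz_coeff_shuffle_part[of i d] dz_coeff_shuffle_part[of "d - i" d] 3
      by (simp add: sum.distrib distrib_right)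
  qed (use dz_coeff_sum[OF assms(1)] choose_d in \<open>simp_all add: sum.distrib distrib_right\<close>)
qed

lemma double_shuffle_dz_coeff: "d \<ge> 1 \<Longrightarrow> double_shuffle_coeffs (dz_coeff d) d"
  by unfold_locales (auto simp: dz_coeff_stuffle dz_coeff_shuffle simp del: of_nat_add)

text \<open>Partial fractions make \<open>K r p q\<close> a rational combination of convergent
  double zeta values of weight \<open>d + 2\<close>, whose images under \<open>\<phi>\<close> are
  coefficients at positive indices.\<close>

lemma K_eq_0_if_dz_coeffs_eq_0:
  assumes "p > 0 \<or> q > 0" "r \<ge> 1" "p + q + r = d + 1" and coeffs: "\<And>e. e \<le> d \<Longrightarrow> dz_coeff d e = 0"
  shows "\<phi> (K r p q) = 0"
proof -
  have dz: "\<phi> (tornheim 0 a b) = 0" if "a \<ge> 1" "b \<ge> 2" "a + b = d + 2" for a b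
  proof -
    have "a = d + 1 - (b - 1)" "b = b - 1 + 1" "b - 1 \<noteq> 0" "b - 1 \<le> d"
      using that by auto
    then show ?thesis
      using coeffs[of "b - 1"] unfolding dz_coeff_def by metis
  qed
  have part: "\<phi> (shuffle_part p q (Suc r)) = 0" if "p > 0 \<or> q > 0" "p + q + r = d + 1" for p q
    using that assms(2) by (auto simp: shuffle_part_def sum of_nat_scale intro!: dz sum.neutral)
  have "admissible p q (Suc r)"
    using assms by (auto simp: admissible_def)
  then have "\<phi> (tornheim p q (Suc r)) = 0"
    using part[of p q] part[of q p] assms(1,3)
    by (simp add: tornheim_eq_shuffle_parts add disj_commute add.commute add.left_commute)
  moreover have "K r p q = of_rat ((-1) ^ r * fact r) * tornheim p q (Suc r)"
    using K_eq_tornheim[OF assms(1,2)] of_rat_of_nat_eq[of "fact r", where 'a = real]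
    by (simp add: of_rat_mult of_rat_power)
  ultimately show ?thesis
    by (simp add: scale)
qed

text \<open>The factorial in \<open>kappa\<close> cancels, and the odd power of the logarithm gives
  the sign.\<close>

lemma dz_coeff_eq_kappa:
  assumes "1 \<le> j" "2 * j \<le> d"
  shows "dz_coeff d (2 * j - 1) = - \<phi> (kappa (2 * j - 1) (d + 1 - 2 * j + 1))"
proof -
  have "kappa (2 * j - 1) (d + 1 - 2 * j + 1) = of_rat (-1) * tornheim 0 (d + 1 - (2 * j - 1)) (2 * j - 1 + 1)"
    using assms by (simp add: kappa_def K_eq_tornheim Suc_diff_le)
  then show ?thesis
    using assms scale[of "-1"] by (simp add: dz_coeff_def)
qed

end

text \<open>Linear separation over the rationals: \<open>x\<close> together with a maximal
  independent subset of \<open>S\<close> is independent, so values on it can be prescribed.\<close>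

lemma ex_functional_vanishing_on:
  assumes "x \<notin> rat_span S"
  obtains \<phi> :: "real \<Rightarrow> real" where
    "\<And>x y. \<phi> (x + y) = \<phi> x + \<phi> y" "\<And>c x. \<phi> (of_rat c * x) = of_rat c * \<phi> x"
    "\<And>y. y \<in> S \<Longrightarrow> \<phi> y = 0" "\<phi> x = 1"
proof -
  interpret P: vector_space_pair "\<lambda>(c::rat) (x::real). of_rat c * x" "\<lambda>(c::rat) (x::real). of_rat c * x"
    by unfold_locales
  obtain B where B: "B \<subseteq> S" "rat_real.independent B" "S \<subseteq> rat_span B"
    using rat_real.maximal_independent_subset by blast
  have x: "x \<notin> rat_span B"
    using assms rat_real.span_mono[OF B(1)] by blast
  then have "rat_real.independent (insert x B)"
    using B(2) by (simp add: rat_real.independent_insert)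
  then obtain g where g: "Vector_Spaces.linear (\<lambda>(c::rat) (x::real). of_rat c * x) (\<lambda>(c::rat) (x::real). of_rat c * x) g"
      "\<forall>b\<in>insert x B. g b = (if b = x then 1 else 0)"
    using P.linear_independent_extend[of "insert x B" "\<lambda>b. if b = x then 1 else 0"] by blast
  interpret g: Vector_Spaces.linear "\<lambda>(c::rat) (x::real). of_rat c * x" "\<lambda>(c::rat) (x::real). of_rat c * x" g
    by (rule g(1))
  have "g y = 0" if "y \<in> S" for y
  proof (rule P.linear_eq_0_on_span[OF g(1)])
    show "g b = 0" if "b \<in> B" for b
      using g(2) that x rat_real.span_base[of b B] by auto
    show "y \<in> rat_span B"
      using that B(3) by blast
  qed
  with that g(2) g.add g.scale show ?thesis by auto
qed

section \<open>Spanning sets according to the parity of the weight\<close>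

lemma K_in_span_even:
  assumes "p > 0 \<or> q > 0" "r \<ge> 1" "even (p + q + r)"
  shows "K r p q \<in> rat_span zeta_products"
proof (rule ccontr)
  assume "K r p q \<notin> rat_span zeta_products"
  then obtain \<phi> :: "real \<Rightarrow> real" where \<phi>:
    "\<And>x y. \<phi> (x + y) = \<phi> x + \<phi> y" "\<And>c x. \<phi> (of_rat c * x) = of_rat c * \<phi> x"
    "\<And>y. y \<in> zeta_products \<Longrightarrow> \<phi> y = 0" "\<phi> (K r p q) = 1"
    using ex_functional_vanishing_on by blast
  then interpret zeta_product_functional \<phi>
    by unfold_locales
  \<comment> \<open>Even weight makes \<open>d\<close> odd, and then all coefficients
    vanish.\<close>
  define d where "d = p + q + r - 1"
  have d: "d \<ge> 1" "odd d" "p + q + r = d + 1"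
    using assms by (auto simp: d_def)
  interpret double_shuffle_coeffs "dz_coeff d" d
    by (rule double_shuffle_dz_coeff[OF d(1)])
  have "\<phi> (K r p q) = 0"
    using assms d coeffs_eq_0_if_odd by (intro K_eq_0_if_dz_coeffs_eq_0) auto
  with \<phi>(4) show False by simp
qed

text \<open>Despite the name no independence is claimed; these constants span together with the zeta
  products.\<close>

definition kappa_basis :: "nat \<Rightarrow> real set" where
  "kappa_basis w = (\<lambda>j. kappa (2 * j - 1) (w - 2 * j + 1)) ` {1..(w - 1) div 6}"

text \<open>A functional that kills \<open>kappa_basis w\<close> kills the coefficients at the odd
  indices up to \<open>2 * (d div 6) - 1\<close> for \<open>d = w - 1\<close>, and these determine
  all the others.\<close>

lemma K_in_span_odd:
  assumes "p > 0 \<or> q > 0" "r \<ge> 1" "odd w" "p + q + r = w"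
  shows "K r p q \<in> rat_span (kappa_basis w \<union> zeta_products)"
proof (rule ccontr)
  assume "K r p q \<notin> rat_span (kappa_basis w \<union> zeta_products)"
  then obtain \<phi> :: "real \<Rightarrow> real" where \<phi>:
    "\<And>x y. \<phi> (x + y) = \<phi> x + \<phi> y" "\<And>c x. \<phi> (of_rat c * x) = of_rat c * \<phi> x"
    "\<And>y. y \<in> kappa_basis w \<union> zeta_products \<Longrightarrow> \<phi> y = 0" "\<phi> (K r p q) = 1"
    using ex_functional_vanishing_on by blast
  then interpret zeta_product_functional \<phi>
    by unfold_locales auto
  define d where "d = w - 1"
  have d: "d \<ge> 1" "even d" "w = d + 1"
    using assms by (auto simp: d_def)
  interpret double_shuffle_coeffs "dz_coeff d" d
    by (rule double_shuffle_dz_coeff[OF d(1)])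
  have "dz_coeff d (2 * j - 1) = 0" if "1 \<le> j" "j \<le> d div 6" for j
  proof -
    have "kappa (2 * j - 1) (d + 1 - 2 * j + 1) \<in> kappa_basis w"
      unfolding kappa_basis_def by (rule image_eqI[of _ _ j]) (use that d in auto)
    then show ?thesis
      using dz_coeff_eq_kappa[of j d] \<phi>(3) that by auto
  qed
  then have "\<phi> (K r p q) = 0"
    using assms d coeffs_eq_0_if_low_odd_coeffs by (intro K_eq_0_if_dz_coeffs_eq_0) auto
  with \<phi>(4) show False by simp
qed

theorem theorem2:
  "(\<forall>p q r :: nat. (p > 0 \<or> q > 0) \<and> r \<ge> 1 \<and> even (p + q + r) \<longrightarrow>
      K r p q \<in> rat_span zeta_products) \<and>
   (\<forall>w :: nat. odd w \<longrightarrow>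
      (\<exists>T \<subseteq> kappa_set w. card T \<le> (w - 1) div 6 \<and>
        (\<forall>p q r :: nat. (p > 0 \<or> q > 0) \<and> r \<ge> 1 \<and> p + q + r = w \<longrightarrow>
          K r p q \<in> rat_span (T \<union> zeta_products))))"
proof (intro conjI allI impI)
  fix w :: nat
  assume w: "odd w"
  have "j \<le> (w + 1) div 4" if "j \<le> (w - 1) div 6" for j
    using that by linarith
  then have "kappa_basis w \<subseteq> kappa_set w"
    by (auto simp: kappa_basis_def kappa_set_def)
  moreover have "card (kappa_basis w) \<le> (w - 1) div 6"
    unfolding kappa_basis_def using card_image_le[of "{1..(w - 1) div 6}"] by simp
  ultimately show "\<exists>T \<subseteq> kappa_set w. card T \<le> (w - 1) div 6 \<and>
        (\<forall>p q r :: nat. (p > 0 \<or> q > 0) \<and> r \<ge> 1 \<and> p + q + r = w \<longrightarrow>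
          K r p q \<in> rat_span (T \<union> zeta_products))"
    using K_in_span_odd[OF _ _ w] by blast
qed (use K_in_span_even in blast)

end
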